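(* Let $(\mathbf{X}, d)$ be a proper geodesic space and let $\Omega\subsetneq \mathbf{X}$ be a bounded domain. Let $$\Lambda_\infty=\frac{1}{\max_{x\in \overline{\Omega}} d(x, \partial \Omega)}$$ and let $$\Lambda=\sup\left\{\lambda\in \mathbb{R}: \text{there exists a locally Lipschitz positive supersolution of } \min\{|\nabla u|-\lambda u,\ -\Delta_\infty u\}=0 \text{ in } \Omega\right\}.$$ Then $\Lambda=\Lambda_\infty$.
   Context: A metric space $(\mathbf{X},d)$ is a geodesic space if any $x,y\in\mathbf{X}$ are joined by a Lipschitz curve of length $d(x,y)$; it is proper if all closed balls $\overline{B_r(x)}$ are compact. $B_r(x)$ is the open metric ball. A domain is a nonempty connected open set; $d(x,E)=\min_{y\in E}d(x,y)$ for compact $E$. $\mathcal{O}\subset\subset\Omega$ means $\overline{\mathcal{O}}\subset\Omega$. $\infty$-superharmonic: a function $u:\Omega\to\mathbb{R}$ bounded from below is $\infty$-superharmonic in $\Omega$ if it satisfies comparison with cones from below: for any $\hat{x}\in\Omega$, $a\in\mathbb{R}$, $\kappa\le 0$ and any bounded open set $\mathcal{O}\subset\subset\Omega$ with $\hat{x}\in\Omega\setminus\mathcal{O}$, if $u\ge\phi$ on $\partial\mathcal{O}$, where $\phi=a+\kappa d(\hat{x},\cdot)$, then $u\ge\phi$ in $\overline{\mathcal{O}}$. Subslope: for locally Lipschitz $u$, $|\nabla^-u|(x)=\limsup_{y\to x}\frac{\max\{u(x)-u(y),0\}}{d(x,y)}$. Supersolution: for $\lambda\in\mathbb{R}$, a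 locally Lipschitz function $u$ in $\Omega$ is a supersolution of $\min\{|\nabla u|-\lambda u,-\Delta_\infty u\}=0$ in $\Omega$ if $u$ is $\infty$-superharmonic in $\Omega$ and $|\nabla^-u|\ge\lambda u$ everywhere in $\Omega$. (The symbols $|\nabla u|$, $\Delta_\infty u$ in the equation are only notation; its meaning is given by this definition.) *)

theory Defs
  imports "HOL-Analysis.Analysis"
begin

text \<open>The ambient metric space is the whole type \<open>'a\<close>; functions on \<open>\<Omega>\<close> are total functions whose
  values outside \<open>\<Omega>\<close> are never used.\<close>

definition curve_length :: "real \<Rightarrow> real \<Rightarrow> (real \<Rightarrow> 'a::metric_space) \<Rightarrow> ereal" where
  "curve_length a b \<gamma> =
     (SUP ts \<in> {ts. sorted ts \<and> set ts \<subseteq> {a..b}}.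
        ereal (\<Sum>i<length ts - 1. dist (\<gamma> (ts ! i)) (\<gamma> (ts ! Suc i))))"

definition geodesic_space :: "'a::metric_space itself \<Rightarrow> bool" where
  "geodesic_space _ \<longleftrightarrow>
     (\<forall>x y :: 'a. \<exists>\<gamma> L. L-lipschitz_on {0..1} \<gamma> \<and> \<gamma> 0 = x \<and> \<gamma> 1 = y \<and>
        curve_length 0 1 \<gamma> = ereal (dist x y))"

definition proper_space :: "'a::metric_space itself \<Rightarrow> bool" where
  "proper_space _ \<longleftrightarrow> (\<forall>(x :: 'a) r. compact (cball x r))"

definition locally_lipschitz_on :: "'a::metric_space set \<Rightarrow> ('a \<Rightarrow> real) \<Rightarrow> bool" where
  "locally_lipschitz_on \<Omega> u \<longleftrightarrow>
     (\<forall>x\<in>\<Omega>. \<exists>r>0. \<exists>L. L-lipschitz_on (ball x r \<inter> \<Omega>) u)"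

definition infty_superharmonic :: "'a::metric_space set \<Rightarrow> ('a \<Rightarrow> real) \<Rightarrow> bool" where
  "infty_superharmonic \<Omega> u \<longleftrightarrow>
     bdd_below (u ` \<Omega>) \<and>
     (\<forall>x0 a \<kappa> U. x0 \<in> \<Omega> - U \<longrightarrow> \<kappa> \<le> 0 \<longrightarrow> open U \<longrightarrow> bounded U \<longrightarrow> closure U \<subseteq> \<Omega> \<longrightarrow>
        (\<forall>x\<in>frontier U. a + \<kappa> * dist x0 x \<le> u x) \<longrightarrow>
        (\<forall>x\<in>closure U. a + \<kappa> * dist x0 x \<le> u x))"

text \<open>At an isolated point of \<open>\<Omega>\<close> this \<open>Limsup\<close> would be \<open>-\<infinity>\<close>; an open subset of a geodesic
  space with at least two points has no isolated points.\<close>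

definition subslope :: "'a::metric_space set \<Rightarrow> ('a \<Rightarrow> real) \<Rightarrow> 'a \<Rightarrow> ereal" where
  "subslope \<Omega> u x =
     Limsup (at x within \<Omega>) (\<lambda>y. ereal (max (u x - u y) 0 / dist x y))"

definition supersolution :: "real \<Rightarrow> 'a::metric_space set \<Rightarrow> ('a \<Rightarrow> real) \<Rightarrow> bool" where
  "supersolution lam \<Omega> u \<longleftrightarrow>
     locally_lipschitz_on \<Omega> u \<and> infty_superharmonic \<Omega> u \<and>
     (\<forall>x\<in>\<Omega>. ereal (lam * u x) \<le> subslope \<Omega> u x)"

text \<open>The supremum is taken in the extended reals, so that an identity with a real number also says
  that the set of admissible values is nonempty and bounded above.\<close>

definition Lambda :: "'a::metric_space set \<Rightarrow> ereal" where
  "Lambda \<Omega> =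
     (SUP lam \<in> {lam :: real. \<exists>u. (\<forall>x\<in>\<Omega>. 0 < u x) \<and> supersolution lam \<Omega> u}. ereal lam)"

text \<open>For a bounded domain of a proper geodesic space other than the whole space, the frontier is
  nonempty and both the infimum in \<open>infdist\<close> and the supremum are attained.\<close>

definition Lambda_infty :: "'a::metric_space set \<Rightarrow> real" where
  "Lambda_infty \<Omega> = 1 / (SUP x\<in>closure \<Omega>. infdist x (frontier \<Omega>))"

end

theory Submission
  imports Defs
begin

text \<open>Write \<open>R\<close> for the largest value of the distance \<open>d\<close> to \<open>\<partial>\<Omega>\<close>, so that
  \<open>\<Lambda>\<^sub>\<infinity> = 1 / R\<close>. Both inequalities come from comparing with cones.

  \<^emph>\<open>Upper bound.\<close> A positive \<open>\<infinity>\<close>-superharmonic function \<open>u\<close> lies, in a ball of radius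
  \<open>r\<close> about \<open>x\<close> whose closure is inside \<open>\<Omega>\<close>, above the cone with vertex \<open>x\<close> that equals \<open>u x\<close>
  at \<open>x\<close> and vanishes on the sphere of radius \<open>r\<close> (\<open>superharmonic_above_cone\<close>). Hence \<open>u\<close>
  decreases from \<open>x\<close> at a rate of at most \<open>u x / r\<close>, and being a supersolution forces
  \<open>lam \<le> 1 / r\<close>. Letting \<open>r\<close> increase to \<open>d x\<close> gives \<open>lam * d x \<le> 1\<close> at every point
  (\<open>supersolution_bound\<close>), and the supremum over \<open>x\<close> gives \<open>lam \<le> 1 / R\<close>.

  \<^emph>\<open>Lower bound.\<close> The function \<open>d\<close> itself is a positive supersolution for \<open>lam = 1 / R\<close>. Its
  subslope is at least 1, because it falls at unit rate along a geodesic to a nearest boundary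
  point, while \<open>d / R \<le> 1\<close>. It is \<open>\<infinity>\<close>-superharmonic because a cone of slope \<open>\<kappa>\<close> with
  \<open>\<bar>\<kappa>\<bar> \<le> 1\<close> can be compared with it along a geodesic to a nearest boundary point, and a steeper
  cone along a geodesic to the vertex (\<open>infdist_infty_superharmonic\<close>).

  The only geometry used is that a geodesic from a point of a set to a point outside it crosses
  the frontier of the set (\<open>geodesic_crosses_frontier\<close>).\<close>


section \<open>Geodesics and frontiers\<close>

text \<open>The length of a curve dominates the sum of the distances over the subdivision with the single
  inner node \<open>t\<close>, so a curve of length \<open>dist x y\<close> has no excess in the triangle inequality at \<open>t\<close>;
  connectedness of the curve supplies a \<open>t\<close> on the frontier.\<close>

lemma geodesic_crosses_frontier:
  fixes x y :: "'a::metric_space"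
  assumes "geodesic_space TYPE('a)" and "x \<in> S" and "y \<notin> S"
  obtains z where "z \<in> frontier S" and "dist x z + dist z y = dist x y"
proof -
  obtain \<gamma> :: "real \<Rightarrow> 'a" and L where lip: "L-lipschitz_on {0..1} \<gamma>"
    and ends: "\<gamma> 0 = x" "\<gamma> 1 = y" and len: "curve_length 0 1 \<gamma> = ereal (dist x y)"
    using assms(1) unfolding geodesic_space_def by metis
  have "connected (\<gamma> ` {0..1})"
    using lip by (intro connected_continuous_image lipschitz_on_continuous_on connected_Icc)
  moreover have "x \<in> \<gamma> ` {0..1}" "y \<in> \<gamma> ` {0..1}"
    using ends by force+
  ultimately have "\<gamma> ` {0..1} \<inter> frontier S \<noteq> {}"
    using assms(2,3) by (intro connected_Int_frontier) auto
  then obtain t where t: "t \<in> {0..1}" "\<gamma> t \<in> frontier S"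
    by blast
  have "ereal (\<Sum>i<length [0, t, 1] - 1. dist (\<gamma> ([0, t, 1] ! i)) (\<gamma> ([0, t, 1] ! Suc i)))
        \<le> curve_length 0 1 \<gamma>"
    unfolding curve_length_def using t(1) by (intro SUP_upper) auto
  then have "dist x (\<gamma> t) + dist (\<gamma> t) y \<le> dist x y"
    by (simp add: len ends numeral_2_eq_2)
  then have "dist x (\<gamma> t) + dist (\<gamma> t) y = dist x y"
    using dist_triangle[of x y "\<gamma> t"] by linarith
  with t(2) show thesis by (rule that)
qed

lemma frontier_ball_dist:
  fixes x :: "'a::metric_space"
  assumes "z \<in> frontier (ball x r)"
  shows "dist x z = r"
proof -
  have "closure (ball x r) \<subseteq> cball x r"
    by (intro closure_minimal ball_subset_cball closed_cball)
  then show ?thesis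
    using assms by (force simp: frontier_def interior_open)
qed

lemma geodesic_point_at_distance:
  fixes x y :: "'a::metric_space"
  assumes "geodesic_space TYPE('a)" and "0 < e" and "e \<le> dist x y"
  obtains z where "dist x z = e" and "dist x z + dist z y = dist x y"
proof -
  obtain z where "z \<in> frontier (ball x e)" "dist x z + dist z y = dist x y"
    using geodesic_crosses_frontier[OF assms(1), of x "ball x e" y] assms(2,3) by auto
  then show thesis
    using that frontier_ball_dist by blast
qed

lemma cball_subset_of_less_infdist_frontier:
  fixes \<Omega> :: "'a::metric_space set"
  assumes "geodesic_space TYPE('a)" and "x \<in> \<Omega>" and "r < infdist x (frontier \<Omega>)"
  shows "cball x r \<subseteq> \<Omega>"
proof
  fix y assume y: "y \<in> cball x r"
  show "y \<in> \<Omega>"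
  proof (rule ccontr)
    assume "y \<notin> \<Omega>"
    then obtain z where z: "z \<in> frontier \<Omega>" "dist x z + dist z y = dist x y"
      using geodesic_crosses_frontier[OF assms(1,2)] by blast
    have "infdist x (frontier \<Omega>) \<le> dist x z"
      using z(1) by (rule infdist_le)
    also have "\<dots> \<le> r"
      using z(2) y zero_le_dist[of z y] by (simp del: zero_le_dist)
    finally show False
      using assms(3) by simp
  qed
qed


section \<open>Upper bound for the admissible values\<close>

text \<open>The vertex of the cone must lie outside the comparison set, which is therefore the punctured
  ball. Its frontier consists of the sphere, where the cone vanishes, and of the vertex, where the
  cone agrees with \<open>u\<close>.\<close>

lemma superharmonic_above_cone:
  fixes \<Omega> :: "'a::metric_space set"
  assumes sup: "infty_superharmonic \<Omega> u" and pos: "\<And>x. x \<in> \<Omega> \<Longrightarrow> 0 < u x"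
    and r: "0 < r" "cball x r \<subseteq> \<Omega>" and y: "dist x y < r"
  shows "u x - u x / r * dist x y \<le> u y"
proof (cases "y = x")
  case False
  define U where "U = ball x r - {x}"
  have xin: "x \<in> \<Omega>"
    using r by auto
  have cl: "closure U \<subseteq> cball x r"
    unfolding U_def by (intro closure_minimal closed_cball) auto
  have "open U" "bounded U"
    by (auto simp: U_def open_delete intro: bounded_subset[OF bounded_ball])
  have "u x + (- (u x / r)) * dist x z \<le> u z" if "z \<in> frontier U" for z
  proof (cases "z = x")
    case False
    have "z \<in> cball x r" "z \<notin> U"
      using that cl \<open>open U\<close> by (auto simp: frontier_def interior_open)
    then have "dist x z = r"
      using False by (auto simp: U_def)
    moreover have "0 < u z"
      using \<open>z \<in> cball x r\<close> r(2) pos by blast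
    ultimately show ?thesis
      using r(1) by simp
  qed simp
  moreover have "x \<in> \<Omega> - U" "- (u x / r) \<le> 0" "closure U \<subseteq> \<Omega>"
    using xin pos[OF xin] r cl by (auto simp: U_def)
  ultimately have "\<forall>z\<in>closure U. u x + (- (u x / r)) * dist x z \<le> u z"
    using sup \<open>open U\<close> \<open>bounded U\<close> unfolding infty_superharmonic_def by blast
  moreover have "y \<in> closure U"
    using closure_subset[of U] y False by (auto simp: U_def)
  ultimately show ?thesis
    by fastforce
qed simp

lemma superharmonic_subslope_le:
  fixes \<Omega> :: "'a::metric_space set"
  assumes "infty_superharmonic \<Omega> u" and pos: "\<And>x. x \<in> \<Omega> \<Longrightarrow> 0 < u x"
    and r: "0 < r" "cball x r \<subseteq> \<Omega>"
  shows "subslope \<Omega> u x \<le> ereal (u x / r)"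
  unfolding subslope_def
proof (rule Limsup_bounded)
  have "0 < u x"
    using r by (intro pos) auto
  have "max (u x - u y) 0 / dist x y \<le> u x / r" if "y \<noteq> x" "dist y x < r" for y
  proof -
    have "u x - u x / r * dist x y \<le> u y"
      using superharmonic_above_cone[OF assms(1) pos r] that(2) by (metis dist_commute)
    then have "max (u x - u y) 0 \<le> u x / r * dist x y"
      using \<open>0 < u x\<close> r(1) by (simp add: algebra_simps)
    then show ?thesis
      using that(1) by (simp add: pos_divide_le_eq)
  qed
  then show "\<forall>\<^sub>F y in at x within \<Omega>. ereal (max (u x - u y) 0 / dist x y) \<le> ereal (u x / r)"
    unfolding eventually_at using r(1) by auto
qed

lemma supersolution_bound:
  fixes \<Omega> :: "'a::metric_space set"
  assumes "geodesic_space TYPE('a)" and pos: "\<And>x. x \<in> \<Omega> \<Longrightarrow> 0 < u x"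
    and "supersolution lam \<Omega> u" and x: "x \<in> \<Omega>"
  shows "lam * infdist x (frontier \<Omega>) \<le> 1"
proof (rule ccontr)
  let ?d = "infdist x (frontier \<Omega>)"
  assume "\<not> ?thesis"
  then have gt: "1 < lam * ?d" by simp
  then have "0 < lam"
    using infdist_nonneg[of x "frontier \<Omega>"] by (smt (verit) mult_nonpos_nonneg)
  then have "1 / lam < ?d"
    using gt by (simp add: field_simps)
  then obtain r where r: "1 / lam < r" "r < ?d"
    using dense by blast
  have "0 < r"
    using r(1) \<open>0 < lam\<close> by (smt (verit) divide_pos_pos)
  have "ereal (lam * u x) \<le> subslope \<Omega> u x"
    using assms(3) x unfolding supersolution_def by blast
  also have "\<dots> \<le> ereal (u x / r)"
    using assms(3) pos \<open>0 < r\<close> cball_subset_of_less_infdist_frontier[OF assms(1) x r(2)]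
    unfolding supersolution_def by (intro superharmonic_subslope_le) auto
  finally have "u x * lam \<le> u x * (1 / r)"
    by (simp add: mult.commute)
  then have "lam \<le> 1 / r"
    using pos[OF x] by (simp only: mult_le_cancel_left_pos)
  with r(1) show False
    using \<open>0 < r\<close> \<open>0 < lam\<close> by (simp add: field_simps)
qed


section \<open>The distance to the boundary as a supersolution\<close>

text \<open>Only the points of \<open>S\<close> that are no farther from \<open>x\<close> than some given point of \<open>S\<close> compete for
  the minimum, and in a proper space they form a compact set.\<close>

lemma proper_space_nearest_point:
  fixes x :: "'a::metric_space"
  assumes "proper_space TYPE('a)" and "closed S" and "S \<noteq> {}"
  obtains y where "y \<in> S" and "infdist x S = dist x y"
proof -
  obtain p where p: "p \<in> S"
    using assms(3) by blast
  have "compact (cball x (dist x p) \<inter> S)"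
    using assms(1,2) unfolding proper_space_def by (intro compact_Int_closed) auto
  moreover have "cball x (dist x p) \<inter> S \<noteq> {}"
    using p by auto
  moreover have "continuous_on (cball x (dist x p) \<inter> S) (dist x)"
    by (intro continuous_intros)
  ultimately obtain y where y: "y \<in> cball x (dist x p) \<inter> S"
    and min: "\<And>z. z \<in> cball x (dist x p) \<inter> S \<Longrightarrow> dist x y \<le> dist x z"
    using continuous_attains_inf[of "cball x (dist x p) \<inter> S" "dist x"] by blast
  have "dist x y \<le> dist x z" if "z \<in> S" for z
    using min[of z] y that by (cases "dist x z \<le> dist x p") auto
  then have "dist x y \<le> infdist x S"
    unfolding infdist_def using assms(3) by (auto intro: cINF_greatest)
  moreover have "infdist x S \<le> dist x y"
    using y by (intro infdist_le) auto
  ultimately show thesis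
    using that y by auto
qed

lemma infdist_along_geodesic:
  fixes x :: "'a::metric_space"
  assumes "p \<in> S" and "infdist x S = dist x p" and "dist x z + dist z p = dist x p"
  shows "infdist x S - infdist z S \<ge> dist x z"
  using infdist_le[OF assms(1), of z] assms(2,3) by linarith

text \<open>Let \<open>x\<close> be in the comparison set \<open>U\<close>. For \<open>-1 \<le> \<kappa>\<close>, leave \<open>U\<close> along a geodesic to a nearest
  boundary point: the distance falls at unit rate, and the cone falls no faster. For \<open>\<kappa> < -1\<close>,
  leave \<open>U\<close> along a geodesic to the vertex: the cone rises at rate \<open>-\<kappa>\<close>, more than the distance
  can. In both cases the excess of the distance over the cone at \<open>x\<close> is at least that at the exit
  point, where it is nonnegative.\<close>

lemma infdist_infty_superharmonic:
  fixes \<Omega> :: "'a::metric_space set"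
  assumes "proper_space TYPE('a)" and geo: "geodesic_space TYPE('a)"
    and "open \<Omega>" and ne: "frontier \<Omega> \<noteq> {}"
  shows "infty_superharmonic \<Omega> (\<lambda>x. infdist x (frontier \<Omega>))"
  unfolding infty_superharmonic_def
proof (intro conjI allI impI ballI)
  let ?d = "\<lambda>x. infdist x (frontier \<Omega>)"
  show "bdd_below (?d ` \<Omega>)"
    by (auto intro!: bdd_belowI[of _ 0] infdist_nonneg)
  fix x0 a \<kappa> U x
  assume x0: "x0 \<in> \<Omega> - U" and \<kappa>: "\<kappa> \<le> (0::real)" and "open U" and clU: "closure U \<subseteq> \<Omega>"
    and fr: "\<forall>z\<in>frontier U. a + \<kappa> * dist x0 z \<le> ?d z" and xcl: "x \<in> closure U"
  show "a + \<kappa> * dist x0 x \<le> ?d x"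
  proof (cases "x \<in> U")
    case False
    then have "x \<in> frontier U"
      using xcl \<open>open U\<close> by (simp add: frontier_def interior_open)
    then show ?thesis
      using fr by blast
  next
    case xU: True
    show ?thesis
    proof (cases "-1 \<le> \<kappa>")
      case True
      obtain p where p: "p \<in> frontier \<Omega>" "?d x = dist x p"
        using proper_space_nearest_point[OF assms(1) frontier_closed ne] by blast
      have "p \<notin> U"
        using p(1) clU closure_subset[of U] \<open>open \<Omega>\<close> by (auto simp: frontier_def interior_open)
      then obtain z where z: "z \<in> frontier U" "dist x z + dist z p = dist x p"
        using geodesic_crosses_frontier[OF geo xU] by blast
      have "\<kappa> * (dist x0 x - dist x0 z) \<le> - \<kappa> * dist x z"
        using mult_left_mono[of "dist x0 z - dist x0 x" "dist x z" "- \<kappa>"]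
          dist_triangle[of x0 z x] \<kappa> by (simp add: algebra_simps)
      moreover have "- \<kappa> * dist x z \<le> dist x z"
        using True mult_right_mono[of "- \<kappa>" 1 "dist x z"] by simp
      moreover have "dist x z \<le> ?d x - ?d z"
        using p z(2) by (intro infdist_along_geodesic)
      moreover have "a + \<kappa> * dist x0 z \<le> ?d z"
        using fr z(1) by blast
      ultimately show ?thesis
        by (simp add: algebra_simps)
    next
      case False
      obtain z where z: "z \<in> frontier U" "dist x z + dist z x0 = dist x x0"
        using geodesic_crosses_frontier[OF geo xU] x0 by blast
      have "dist x0 x = dist x0 z + dist x z"
        using z(2) by (simp add: dist_commute)
      then have "\<kappa> * dist x0 x = \<kappa> * dist x0 z + \<kappa> * dist x z"
        by (simp add: distrib_left)
      moreover have "\<kappa> * dist x z \<le> - dist x z"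
        using False mult_right_mono[of \<kappa> "-1" "dist x z"] by simp
      moreover have "?d z \<le> ?d x + dist x z"
        using infdist_triangle[of z "frontier \<Omega>" x] by (simp add: dist_commute)
      moreover have "a + \<kappa> * dist x0 z \<le> ?d z"
        using fr z(1) by blast
      ultimately show ?thesis
        by linarith
    qed
  qed
qed

lemma infdist_subslope_ge_1:
  fixes \<Omega> :: "'a::metric_space set"
  assumes "proper_space TYPE('a)" and geo: "geodesic_space TYPE('a)"
    and "open \<Omega>" and ne: "frontier \<Omega> \<noteq> {}" and x: "x \<in> \<Omega>"
  shows "1 \<le> subslope \<Omega> (\<lambda>x. infdist x (frontier \<Omega>)) x"
proof -
  let ?d = "\<lambda>x. infdist x (frontier \<Omega>)"
  let ?q = "\<lambda>y. max (?d x - ?d y) 0 / dist x y"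
  obtain p where p: "p \<in> frontier \<Omega>" "?d x = dist x p"
    using proper_space_nearest_point[OF assms(1) frontier_closed ne] by blast
  have "x \<noteq> p"
    using p(1) x \<open>open \<Omega>\<close> by (auto simp: frontier_def interior_open)
  obtain e0 where e0: "0 < e0" "ball x e0 \<subseteq> \<Omega>"
    using \<open>open \<Omega>\<close> x open_contains_ball by blast
  have near: "\<exists>y\<in>\<Omega>. y \<noteq> x \<and> dist y x < e \<and> 1 \<le> ?q y" if "0 < e" for e
  proof -
    define s where "s = min (dist x p) (min e e0 / 2)"
    have s: "0 < s" "s \<le> dist x p" "s < e" "s < e0"
      using that e0(1) \<open>x \<noteq> p\<close> by (auto simp: s_def)
    obtain z where z: "dist x z = s" "dist x z + dist z p = dist x p"
      using geodesic_point_at_distance[OF geo s(1,2)] by blast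
    have "dist x z \<le> ?d x - ?d z"
      using p z(2) by (intro infdist_along_geodesic)
    then have "1 \<le> ?q z"
      using z(1) s(1) by (simp add: le_divide_eq)
    moreover have "z \<in> \<Omega>" "z \<noteq> x" "dist z x < e"
      using z(1) s e0(2) by (auto simp: dist_commute)
    ultimately show ?thesis
      by blast
  qed
  show ?thesis
    unfolding subslope_def Limsup_def
  proof (rule INF_greatest)
    fix P assume "P \<in> {P. eventually P (at x within \<Omega>)}"
    then obtain e where e: "0 < e" "\<And>y. y \<in> \<Omega> \<Longrightarrow> y \<noteq> x \<Longrightarrow> dist y x < e \<Longrightarrow> P y"
      unfolding eventually_at by blast
    from near[OF e(1)] obtain y where "P y" "1 \<le> ?q y"
      using e(2) by blast
    then show "1 \<le> (SUP y\<in>Collect P. ereal (?q y))"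
      by (intro SUP_upper2[of y]) auto
  qed
qed


lemma infdist_supersolution:
  fixes \<Omega> :: "'a::metric_space set"
  assumes "proper_space TYPE('a)" and "geodesic_space TYPE('a)"
    and "open \<Omega>" and "frontier \<Omega> \<noteq> {}"
    and le: "\<And>x. x \<in> \<Omega> \<Longrightarrow> lam * infdist x (frontier \<Omega>) \<le> 1"
  shows "supersolution lam \<Omega> (\<lambda>x. infdist x (frontier \<Omega>))"
  unfolding supersolution_def
proof (intro conjI ballI)
  have "1-lipschitz_on A (\<lambda>x. infdist x (frontier \<Omega>))" for A
    by (intro lipschitz_onI) (auto simp: dist_real_def infdist_triangle_abs)
  then show "locally_lipschitz_on \<Omega> (\<lambda>x. infdist x (frontier \<Omega>))"
    unfolding locally_lipschitz_on_def using zero_less_one by blast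
  show "infty_superharmonic \<Omega> (\<lambda>x. infdist x (frontier \<Omega>))"
    using assms(1-4) by (rule infdist_infty_superharmonic)
  fix x assume x: "x \<in> \<Omega>"
  have "ereal (lam * infdist x (frontier \<Omega>)) \<le> 1"
    using le[OF x] by simp
  also have "1 \<le> subslope \<Omega> (\<lambda>x. infdist x (frontier \<Omega>)) x"
    using assms(1-4) x by (rule infdist_subslope_ge_1)
  finally show "ereal (lam * infdist x (frontier \<Omega>)) \<le> subslope \<Omega> (\<lambda>x. infdist x (frontier \<Omega>)) x" .
qed


section \<open>Equality of the two constants\<close>

theorem theorem1p1:
  fixes \<Omega> :: "'a::metric_space set"
  assumes "proper_space TYPE('a)" and "geodesic_space TYPE('a)"
    and "open \<Omega>" and "connected \<Omega>" and "\<Omega> \<noteq> {}" and "bounded \<Omega>" and "\<Omega> \<noteq> UNIV"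
  shows "Lambda \<Omega> = ereal (Lambda_infty \<Omega>)"
proof -
  let ?d = "\<lambda>x. infdist x (frontier \<Omega>)"
  define R where "R = (SUP x\<in>closure \<Omega>. ?d x)"
  obtain x1 where x1: "x1 \<in> \<Omega>"
    using assms(5) by blast
  obtain q where q: "q \<in> frontier \<Omega>"
    using geodesic_crosses_frontier[OF assms(2) x1] assms(7) by blast
  then have ne: "frontier \<Omega> \<noteq> {}"
    by blast
  obtain B where B: "\<And>x. x \<in> closure \<Omega> \<Longrightarrow> dist q x \<le> B"
    using bounded_any_center[THEN iffD1, OF bounded_closure[OF assms(6)]] by blast
  have "bdd_above (?d ` closure \<Omega>)"
    using B infdist_le[OF q] by (intro bdd_aboveI2[of _ _ B]) (metis dist_commute order_trans)
  then have d_le_R: "?d x \<le> R" if "x \<in> closure \<Omega>" for x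
    unfolding R_def using that by (intro cSUP_upper)
  have d_pos: "0 < ?d x" if "x \<in> \<Omega>" for x
    using that assms(3) ne infdist_pos_not_in_closed[of "frontier \<Omega>" x]
    by (auto simp: frontier_def interior_open)
  have "0 < R"
    using d_pos[OF x1] d_le_R x1 closure_subset[of \<Omega>] by (meson less_le_trans subsetD)
  have "lam \<le> 1 / R" if "\<forall>x\<in>\<Omega>. 0 < u x" "supersolution lam \<Omega> u" for lam u
  proof (cases "0 < lam")
    case True
    have "?d x \<le> 1 / lam" if x: "x \<in> closure \<Omega>" for x
    proof (cases "x \<in> \<Omega>")
      case xin: True
      then have "lam * ?d x \<le> 1"
        using supersolution_bound[OF assms(2), of \<Omega> u lam x]
          \<open>\<forall>x\<in>\<Omega>. 0 < u x\<close> \<open>supersolution lam \<Omega> u\<close> by blast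
      then show ?thesis
        using True by (simp add: field_simps)
    next
      case False
      then have "?d x = 0"
        using x assms(3) by (simp add: frontier_def interior_open)
      then show ?thesis
        using True by simp
    qed
    then have "R \<le> 1 / lam"
      unfolding R_def using assms(5) by (intro cSUP_least) auto
    then show ?thesis
      using True \<open>0 < R\<close> by (simp add: field_simps)
  next
    case False
    then show ?thesis
      using \<open>0 < R\<close> by (smt (verit) divide_pos_pos)
  qed
  then have upper: "Lambda \<Omega> \<le> ereal (1 / R)"
    unfolding Lambda_def by (intro SUP_least) auto
  have "1 / R * ?d x \<le> 1" if "x \<in> \<Omega>" for x
    using d_le_R[of x] that closure_subset[of \<Omega>] \<open>0 < R\<close> by (auto simp: field_simps)
  then have "supersolution (1 / R) \<Omega> ?d"
    using infdist_supersolution[OF assms(1-3) ne] by blast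
  then have "\<exists>u. (\<forall>x\<in>\<Omega>. 0 < u x) \<and> supersolution (1 / R) \<Omega> u"
    using d_pos by (intro exI[of _ ?d]) blast
  then have "ereal (1 / R) \<le> Lambda \<Omega>"
    unfolding Lambda_def by (intro SUP_upper CollectI)
  with upper show ?thesis
    unfolding Lambda_infty_def R_def by (rule antisym)
qed

end
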